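(* For every integer $m\ge 3$ there exists a completely uniform nested $2$-$(2^m,4,3)$ design.
   Context: A $2$-$(v,4,\lambda)$ design is a pair $(V,\mathcal{C})$ with $|V|=v$ and $\mathcal{C}$ a collection of $4$-subsets (blocks) such that every $2$-subset of $V$ lies in exactly $\lambda$ blocks. A nested $2$-$(v,4,\lambda)$ design is a pair $(V,\mathscr{C})$ where each element of $\mathscr{C}$ is a partition $\{x,y\mid z,w\}=\{\{x,y\},\{z,w\}\}$ of a $4$-subset of $V$ into two pairs, such that $(V,\{\{x,y,z,w\}:\{x,y\mid z,w\}\in\mathscr{C}\})$ is a $2$-$(v,4,\lambda)$ design (each block partitioned once). The multiplicity of a pair in $\binom{V}{2}$ is the number of elements of $\mathscr{C}$ having it as one of their two parts; the nested design is completely uniform if all pairs in $\binom{V}{2}$ have the same positive multiplicity. *)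

theory Defs
  imports Main "HOL-Library.Disjoint_Sets" "HOL-Library.Ramsey"
begin

text \<open>Blocks form a set, so designs are simple (no repeated blocks).\<close>

definition design_2_4 :: "nat \<Rightarrow> nat \<Rightarrow> 'a set \<Rightarrow> 'a set set \<Rightarrow> bool" where
  "design_2_4 v l V C \<longleftrightarrow>
     finite V \<and> card V = v \<and> C \<subseteq> nsets V 4 \<and>
     (\<forall>P \<in> nsets V 2. card {B \<in> C. P \<subseteq> B} = l)"

text \<open>A split block \<open>{{x, y}, {z, w}}\<close> is a set of two pairs; its underlying block
  \<open>{x, y, z, w}\<close> is recovered as its union.\<close>

definition split_block :: "'a set \<Rightarrow> 'a set set \<Rightarrow> bool" where
  "split_block V p \<longleftrightarrow>
     (\<exists>B \<in> nsets V 4. partition_on B p \<and> card p = 2 \<and> p \<subseteq> nsets B 2)"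

text \<open>Injectivity of \<open>\<Union>\<close> on \<open>S\<close> says that each block is partitioned exactly once.\<close>

definition nested_design_2_4 :: "nat \<Rightarrow> nat \<Rightarrow> 'a set \<Rightarrow> 'a set set set \<Rightarrow> bool" where
  "nested_design_2_4 v l V S \<longleftrightarrow>
     (\<forall>p \<in> S. split_block V p) \<and> inj_on \<Union> S \<and> design_2_4 v l V (\<Union> ` S)"

definition pair_multiplicity :: "'a set set set \<Rightarrow> 'a set \<Rightarrow> nat" where
  "pair_multiplicity S P = card {p \<in> S. P \<in> p}"

definition completely_uniform :: "'a set \<Rightarrow> 'a set set set \<Rightarrow> bool" where
  "completely_uniform V S \<longleftrightarrow>
     (\<exists>k > 0. \<forall>P \<in> nsets V 2. pair_multiplicity S P = k)"

end

theory Submission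
  imports Defs
begin

text \<open>
  A count shows that every pair must be a part of exactly one split block. Identify the points
  with the vectors of the elementary abelian 2-group of order \<open>2 ^ m\<close> (natural numbers under
  bitwise XOR, written \<open>+\<close> here) and split each affine plane
  \<open>x + {0, d, f d, d + f d}\<close> as \<open>{x, x + d | x + f d, x + d + f d}\<close>.
  The pair \<open>{a, b}\<close> is then a part only for \<open>d = a + b\<close>. If \<open>f\<close> and \<open>d \<mapsto> d + f d\<close> are
  permutations fixing 0, then \<open>a + b\<close> lies in exactly three of the planes through 0, so \<open>{a, b}\<close>
  lies in three blocks; these planes are distinct provided that \<open>f (f d)\<close> avoids \<open>d\<close> and
  \<open>d + f d\<close>, and \<open>f (d + f d) \<noteq> d\<close>, for \<open>d \<noteq> 0\<close>.
  Multiplication by a field element outside the subfield of order 4 is such a map. It is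
  needed for \<open>m = 3, 4, 5\<close> only, because direct sums of such maps are again such maps.
\<close>

unbundle bit_operations_syntax

section \<open>XOR as the addition of an elementary abelian 2-group\<close>

lemma xor_cancel: "(x::nat) XOR (x XOR y) = y"
  by (simp flip: xor.assoc)

lemma xor_eq_iff: "(x::nat) XOR y = z \<longleftrightarrow> y = x XOR z"
  by (metis xor_cancel)

lemma xor_left_cancel_iff: "(x::nat) XOR y = x XOR z \<longleftrightarrow> y = z"
  by (metis xor_cancel)

lemma xor_eq_0_iff: "(x::nat) XOR y = 0 \<longleftrightarrow> x = y"
  by (auto simp: xor_eq_iff)

lemma xor_same_iff:
  "(x::nat) XOR y = x \<longleftrightarrow> y = 0" "x = x XOR y \<longleftrightarrow> y = 0" "x = y XOR x \<longleftrightarrow> y = 0"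
  using xor_left_cancel_iff[of x y 0] by (auto simp: xor.commute)

lemma xor_less_exp: "(x::nat) < 2 ^ m \<Longrightarrow> y < 2 ^ m \<Longrightarrow> x XOR y < 2 ^ m"
  by (simp add: take_bit_nat_eq_self_iff[symmetric])

section \<open>Nesting maps in dimensions 3, 4 and 5\<close>

definition nesting_map :: "nat \<Rightarrow> (nat \<Rightarrow> nat) \<Rightarrow> bool" where
  "nesting_map m f \<longleftrightarrow>
     f 0 = 0 \<and> (\<forall>x < 2 ^ m. f x < 2 ^ m) \<and>
     inj_on f {..<2 ^ m} \<and> inj_on (\<lambda>x. x XOR f x) {..<2 ^ m} \<and>
     (\<forall>x < 2 ^ m. x \<noteq> 0 \<longrightarrow> f (f x) \<noteq> x \<and> f (f x) \<noteq> x XOR f x \<and> f (x XOR f x) \<noteq> x)"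

text \<open>Multiplication by X modulo the polynomial over the two-element field whose coefficients
  are the bits of \<open>p\<close>. The bit of the leading term is included in \<open>p\<close>, so
  the XOR clears the overflow in bit \<open>m\<close>.\<close>

definition mult_X :: "nat \<Rightarrow> nat \<Rightarrow> nat \<Rightarrow> nat" where
  "mult_X m p x = (if 2 * x < 2 ^ m then 2 * x else (2 * x) XOR p)"

text \<open>Predicates on explicit lists can be evaluated by the simplifier for a concrete
  \<open>m\<close>.\<close>

lemma nesting_map_code:
  "nesting_map m f \<longleftrightarrow>
     f 0 = 0 \<and> list_all (\<lambda>x. f x < 2 ^ m) [0..<2 ^ m] \<and>
     distinct (map f [0..<2 ^ m]) \<and> distinct (map (\<lambda>x. x XOR f x) [0..<2 ^ m]) \<and>
     list_all (\<lambda>x. f (f x) \<noteq> x \<and> f (f x) \<noteq> x XOR f x \<and> f (x XOR f x) \<noteq> x) [1..<2 ^ m]"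
  unfolding nesting_map_def list_all_iff distinct_map
  by (auto simp: atLeast0LessThan Suc_le_eq)

lemma upt_from_0_1:
  "0 < n \<Longrightarrow> [0..<n] = 0 # [Suc 0..<n]"
  "Suc 0 < n \<Longrightarrow> [Suc 0..<n] = Suc 0 # [2..<n]"
  by (simp_all add: upt_conv_Cons numeral_2_eq_2)

text \<open>Unfolding only at literals makes nested applications evaluate from the inside
  out.\<close>

lemmas mult_X_eval =
  mult_X_def[of _ _ 0] mult_X_def[of _ _ "Suc 0"] mult_X_def[of _ _ "numeral k" for k]
  numeral_3_eq_3[symmetric]

text \<open>The binary digits of 11, 19 and 37 are the coefficients of the irreducible polynomials
  \<open>X\<^sup>3 + X + 1\<close>, \<open>X\<^sup>4 + X + 1\<close> and \<open>X\<^sup>5 + X\<^sup>2 + 1\<close> over the field with two elements.\<close>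

lemma nesting_map_mult_X:
  "nesting_map 3 (mult_X 3 11)" "nesting_map 4 (mult_X 4 19)" "nesting_map 5 (mult_X 5 37)"
  unfolding nesting_map_code by (simp_all add: upt_from_0_1 mult_X_eval)

section \<open>Direct sums and all dimensions from 3 on\<close>

lemma eq_iff_take_drop_bit: "x = y \<longleftrightarrow> take_bit n x = take_bit n y \<and> drop_bit n x = drop_bit n y"
  for x y :: nat
  by (metis bits_ident)

text \<open>The low \<open>a\<close> bits and the remaining high bits are the two summands, and both
  projections commute with XOR. An equation that would violate a condition for the sum projects to
  the same equation for \<open>f\<close> and for \<open>g\<close>, which settles each
  component.\<close>

lemma nesting_map_sum:
  assumes f: "nesting_map a f" and g: "nesting_map b g"
  shows "nesting_map (a + b) (\<lambda>x. f (take_bit a x) XOR push_bit a (g (drop_bit a x)))"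
proof -
  define h where "h x = f (take_bit a x) XOR push_bit a (g (drop_bit a x))" for x
  have f_less: "f x < 2 ^ a" if "x < 2 ^ a" for x
    using f that by (simp add: nesting_map_def)
  have T: "take_bit a (h x) = f (take_bit a x)" for x
    by (simp add: h_def take_bit_push_bit f_less take_bit_nat_eq_self)
  have D: "drop_bit a (h x) = g (drop_bit a x)" for x
  proof -
    have "drop_bit a (f (take_bit a x)) = 0" by (simp add: f_less drop_bit_eq_div)
    then show ?thesis by (simp add: h_def drop_bit_push_bit)
  qed
  \<comment> \<open>Only the high part needs a bound; the low part is always below
    \<open>2 ^ a\<close>.\<close>
  have less: "x < 2 ^ (a + b) \<longleftrightarrow> drop_bit a x < 2 ^ b" for x :: nat
    by (simp add: drop_bit_eq_div power_add div_less_iff_less_mult mult.commute)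
  have t: "take_bit a x < 2 ^ a" for x :: nat by simp
  have inj: "x = y" if "nesting_map n k" "x < 2 ^ n" "y < 2 ^ n"
    "k x = k y \<or> x XOR k x = y XOR k y" for n k x y
  proof -
    have "inj_on k {..<2 ^ n}" "inj_on (\<lambda>x. x XOR k x) {..<2 ^ n}"
      using that(1) by (simp_all add: nesting_map_def)
    then show ?thesis using that(2-4) inj_onD[of _ "{..<2 ^ n}" x y] by auto
  qed
  have free: "x = 0" if "nesting_map n k" "x < 2 ^ n"
    "k (k x) = x \<or> k (k x) = x XOR k x \<or> k (x XOR k x) = x" for n k x
    using that unfolding nesting_map_def by blast
  have inj_h: "x = y" if x: "x < 2 ^ (a + b)" and y: "y < 2 ^ (a + b)"
    and eq: "h x = h y \<or> x XOR h x = y XOR h y" for x y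
  proof -
    have "f (take_bit a x) = f (take_bit a y) \<or>
        take_bit a x XOR f (take_bit a x) = take_bit a y XOR f (take_bit a y)"
      using eq by (metis T take_bit_xor)
    then have "take_bit a x = take_bit a y" by (rule inj[OF f t t])
    moreover have "g (drop_bit a x) = g (drop_bit a y) \<or>
        drop_bit a x XOR g (drop_bit a x) = drop_bit a y XOR g (drop_bit a y)"
      using eq by (metis D drop_bit_xor)
    then have "drop_bit a x = drop_bit a y" by (rule inj[OF g x[unfolded less] y[unfolded less]])
    ultimately show ?thesis using eq_iff_take_drop_bit by blast
  qed
  have free_h: "x = 0" if x: "x < 2 ^ (a + b)"
    and eq: "h (h x) = x \<or> h (h x) = x XOR h x \<or> h (x XOR h x) = x" for x
  proof -
    have "f (f (take_bit a x)) = take_bit a x \<or> f (f (take_bit a x)) = take_bit a x XOR f (take_bit a x) \<or>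
        f (take_bit a x XOR f (take_bit a x)) = take_bit a x"
      using eq by (metis T take_bit_xor)
    then have "take_bit a x = 0" by (rule free[OF f t])
    moreover have "g (g (drop_bit a x)) = drop_bit a x \<or> g (g (drop_bit a x)) = drop_bit a x XOR g (drop_bit a x) \<or>
        g (drop_bit a x XOR g (drop_bit a x)) = drop_bit a x"
      using eq by (metis D drop_bit_xor)
    then have "drop_bit a x = 0" by (rule free[OF g x[unfolded less]])
    ultimately show ?thesis using eq_iff_take_drop_bit[of x 0 a] by simp
  qed
  have "h 0 = 0" using f g by (simp add: h_def nesting_map_def)
  moreover have "h x < 2 ^ (a + b)" if "x < 2 ^ (a + b)" for x
    using that g unfolding less D by (simp add: nesting_map_def)
  ultimately have "nesting_map (a + b) h"
    using inj_h free_h unfolding nesting_map_def inj_on_def lessThan_iff Ball_def by blast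
  then show ?thesis unfolding h_def .
qed

text \<open>Splitting off summands of dimension 3 reduces \<open>m\<close> to one of 3, 4, 5, which
  cover the residues modulo 3.\<close>

lemma nesting_map_exists:
  assumes "m \<ge> 3"
  shows "\<exists>f. nesting_map m f"
  using assms
proof (induction m rule: less_induct)
  case (less m)
  show ?case
  proof (cases "m < 6")
    case True
    then have "m = 3 \<or> m = 4 \<or> m = 5" using less.prems by arith
    then show ?thesis using nesting_map_mult_X by blast
  next
    case False
    then have "m - 3 < m" "m - 3 \<ge> 3" by auto
    then obtain f where "nesting_map (m - 3) f" using less.IH by blast
    from nesting_map_sum[OF this nesting_map_mult_X(1)] False show ?thesis by auto
  qed
qed

section \<open>Affine planes and their splittings\<close>

definition plane :: "(nat \<Rightarrow> nat) \<Rightarrow> nat \<Rightarrow> nat set" where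
  "plane f d = {0, d, f d, d XOR f d}"

definition split_plane :: "(nat \<Rightarrow> nat) \<Rightarrow> nat \<Rightarrow> nat \<Rightarrow> nat set set" where
  "split_plane f x d = {{x, x XOR d}, {x XOR f d, x XOR d XOR f d}}"

definition split_planes :: "nat \<Rightarrow> (nat \<Rightarrow> nat) \<Rightarrow> nat set set set" where
  "split_planes m f = {split_plane f x d |x d. x < 2 ^ m \<and> d < 2 ^ m \<and> d \<noteq> 0}"

lemma Union_split_plane: "\<Union> (split_plane f x d) = (XOR) x ` plane f d"
  by (auto simp: split_plane_def plane_def)

lemma Union_split_planes:
  "\<Union> ` split_planes m f = {(XOR) x ` plane f d |x d. x < 2 ^ m \<and> d < 2 ^ m \<and> d \<noteq> 0}"
  unfolding split_planes_def Union_split_plane[symmetric] by blast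

lemmas xor_simps = xor.assoc xor.commute xor.left_commute xor_cancel

text \<open>Adding \<open>d\<close> swaps the points inside each pair, adding \<open>f d\<close>
  swaps the two pairs, and adding \<open>d XOR f d\<close> does both.\<close>

lemma split_plane_translate:
  assumes "w \<in> plane f d"
  shows "split_plane f (x XOR w) d = split_plane f x d"
proof -
  have "w = 0 \<or> w = d \<or> w = f d \<or> w = d XOR f d" using assms by (simp add: plane_def)
  then show ?thesis
    unfolding split_plane_def
    by (elim disjE; simp add: xor_simps insert_commute)
qed

text \<open>Any point of a block may serve as its base point; blocks are compared below after moving
  to a common one.\<close>

lemma block_translate:
  assumes "y \<in> (XOR) x ` plane f d"
  shows "split_plane f y d = split_plane f x d" "(XOR) y ` plane f d = (XOR) x ` plane f d"
proof -
  show "split_plane f y d = split_plane f x d"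
    using assms split_plane_translate by auto
  then show "(XOR) y ` plane f d = (XOR) x ` plane f d"
    by (simp only: Union_split_plane[symmetric])
qed

lemma xor_image_eq_iff: "(XOR) (x::nat) ` A = (XOR) x ` B \<longleftrightarrow> A = B"
  by (rule inj_image_eq_iff) (metis injI xor_cancel)

section \<open>The nested design of a nesting map\<close>

context
  fixes m :: nat and f :: "nat \<Rightarrow> nat"
  assumes nm: "nesting_map m f"
begin

lemma nesting_map_less: "d < 2 ^ m \<Longrightarrow> f d < 2 ^ m"
  using nm by (simp add: nesting_map_def)

lemma nesting_map_distinct:
  assumes "d < 2 ^ m" "d \<noteq> 0"
  shows "f d \<noteq> 0" "f d \<noteq> d"
proof -
  have 0: "f 0 = 0" "inj_on f {..<2 ^ m}" "inj_on (\<lambda>x. x XOR f x) {..<2 ^ m}"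
    using nm by (auto simp: nesting_map_def)
  show "f d \<noteq> 0" using inj_onD[OF 0(2), of d 0] assms 0(1) by auto
  show "f d \<noteq> d" using inj_onD[OF 0(3), of d 0] assms 0(1) by auto
qed

text \<open>If \<open>d \<noteq> e\<close>, then \<open>e\<close> is \<open>f d\<close> or
  \<open>d XOR f d\<close>, and \<open>f e\<close> is a nonzero point of the same plane other than
  \<open>e\<close> and \<open>f d\<close>. In the first case \<open>f (f d)\<close> would be
  \<open>d\<close> or \<open>d XOR f d\<close>, in the second \<open>f (d XOR f d)\<close> would be
  \<open>d\<close>.\<close>

lemma plane_inj:
  assumes "d < 2 ^ m" "d \<noteq> 0" "e < 2 ^ m" "e \<noteq> 0" "plane f d = plane f e"
  shows "d = e"
proof (rule ccontr)
  assume "d \<noteq> e"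
  have inj: "f x = f y \<Longrightarrow> x = y" if "x < 2 ^ m" "y < 2 ^ m" for x y
    using nm that by (auto simp: nesting_map_def inj_on_def)
  have free: "f (f d) \<noteq> d" "f (f d) \<noteq> d XOR f d" "f (d XOR f d) \<noteq> d"
    using nm assms by (auto simp: nesting_map_def)
  have "e \<in> plane f d" "f e \<in> plane f d"
    unfolding assms(5) by (simp_all add: plane_def)
  then have e: "e = f d \<or> e = d XOR f d" "f e \<in> {d, f d, d XOR f d}"
    using assms(4) \<open>d \<noteq> e\<close> nesting_map_distinct[OF assms(3,4)] unfolding plane_def by blast+
  have "f e \<noteq> e" "f e \<noteq> f d"
    using nesting_map_distinct[OF assms(3,4)] inj[of e d] assms \<open>d \<noteq> e\<close> by auto
  with e free show False by auto
qed

lemma split_plane_is_split_block: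
  assumes "x < 2 ^ m" "d < 2 ^ m" "d \<noteq> 0"
  shows "split_block {..<2 ^ m} (split_plane f x d)"
proof -
  have ne: "f d \<noteq> 0" "f d \<noteq> d" using nesting_map_distinct assms by auto
  define a b c where abc: "a = x XOR d" "b = x XOR f d" "c = x XOR d XOR f d"
  have dist: "distinct [x, a, b, c]"
    using ne assms(3) unfolding abc
    by (auto simp: xor_same_iff xor_eq_0_iff xor_left_cancel_iff)
  have less: "a < 2 ^ m" "b < 2 ^ m" "c < 2 ^ m"
    using assms by (auto simp: abc nesting_map_less xor_less_exp)
  have p: "split_plane f x d = {{x, a}, {b, c}}" by (simp add: split_plane_def abc)
  have "{x, a, b, c} \<in> nsets {..<2 ^ m} 4"
    using dist less assms by (auto simp: nsets_def)
  moreover have "partition_on {x, a, b, c} {{x, a}, {b, c}}"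
    using dist by (auto simp: partition_on_def disjoint_def)
  moreover have "card {{x, a}, {b, c}} = 2" using dist by (auto simp: card_insert_if doubleton_eq_iff)
  moreover have "{{x, a}, {b, c}} \<subseteq> nsets {x, a, b, c} 2" using dist by (auto simp: nsets_def)
  ultimately show ?thesis unfolding split_block_def p by blast
qed

lemma Union_inj_on_split_planes: "inj_on \<Union> (split_planes m f)"
proof (rule inj_onI)
  fix p q assume "p \<in> split_planes m f" "q \<in> split_planes m f" and eq: "\<Union> p = \<Union> q"
  then obtain x d y e where p: "p = split_plane f x d" "d < 2 ^ m" "d \<noteq> 0"
    and q: "q = split_plane f y e" "e < 2 ^ m" "e \<noteq> 0"
    by (auto simp: split_planes_def)
  have "y \<in> (XOR) y ` plane f e" by (auto simp: plane_def image_iff)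
  then have y: "y \<in> (XOR) x ` plane f d" using eq by (simp add: p q Union_split_plane)
  then have "(XOR) y ` plane f d = (XOR) y ` plane f e"
    using block_translate(2)[OF y] eq unfolding p(1) q(1) Union_split_plane by simp
  then have "d = e" using plane_inj p q by (simp add: xor_image_eq_iff)
  then show "p = q" using block_translate(1)[OF y] p q by simp
qed

lemma split_planes_multiplicity:
  assumes "P \<in> nsets {..<2 ^ m} 2"
  shows "pair_multiplicity (split_planes m f) P = 1"
proof -
  obtain a b where P: "P = {a, b}" "a \<noteq> b" "a < 2 ^ m" "b < 2 ^ m"
    using assms by (auto simp: nsets_def card_2_iff)
  have d: "a XOR b < 2 ^ m" "a XOR b \<noteq> 0" using P by (auto simp: xor_less_exp xor_eq_iff)
  have "{p \<in> split_planes m f. P \<in> p} = {split_plane f a (a XOR b)}"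
  proof (intro equalityI subsetI)
    fix p assume "p \<in> {split_plane f a (a XOR b)}"
    moreover have "P \<in> split_plane f a (a XOR b)"
      by (simp add: split_plane_def xor_cancel P(1))
    ultimately show "p \<in> {p \<in> split_planes m f. P \<in> p}"
      using P(3) d unfolding split_planes_def by blast
  next
    fix p assume "p \<in> {p \<in> split_planes m f. P \<in> p}"
    then obtain x e where p: "p = split_plane f x e" "P \<in> split_plane f x e"
      by (auto simp: split_planes_def)
    \<comment> \<open>Both parts of the split block have difference \<open>e\<close>.\<close>
    have "e = a XOR b"
      using p(2) unfolding split_plane_def P(1) insert_iff doubleton_eq_iff
      by (elim disjE conjE; simp add: xor_simps)
    moreover have "a \<in> (XOR) x ` plane f e"
      using p(2) Union_split_plane[of f x e] P by blast
    ultimately show "p \<in> {split_plane f a (a XOR b)}"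
      using block_translate(1) p by simp
  qed
  then show ?thesis by (simp add: pair_multiplicity_def)
qed

lemma split_planes_design: "design_2_4 (2 ^ m) 3 {..<2 ^ m} (\<Union> ` split_planes m f)"
proof -
  have "\<Union> ` split_planes m f \<subseteq> nsets {..<2 ^ m} 4"
  proof clarify
    fix p assume "p \<in> split_planes m f"
    then have "split_block {..<2 ^ m} p"
      by (auto simp: split_planes_def split_plane_is_split_block)
    then show "\<Union> p \<in> nsets {..<2 ^ m} 4"
      by (auto simp: split_block_def partition_on_def)
  qed
  moreover have "card {B \<in> \<Union> ` split_planes m f. P \<subseteq> B} = 3" if pair: "P \<in> nsets {..<2 ^ m} 2" for P
  proof -
    obtain a b where P: "P = {a, b}" "a \<noteq> b" "a < 2 ^ m" "b < 2 ^ m"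
      using pair by (auto simp: nsets_def card_2_iff)
    define c where "c = a XOR b"
    have c: "c < 2 ^ m" "c \<noteq> 0" using P by (auto simp: c_def xor_less_exp xor_eq_iff)
    have injs: "inj_on f {..<2 ^ m}" "inj_on (\<lambda>x. x XOR f x) {..<2 ^ m}" and f0: "f 0 = 0"
      using nm by (auto simp: nesting_map_def)
    \<comment> \<open>Injective self-maps of a finite set are onto, so \<open>c\<close> has a
      preimage under each.\<close>
    have "f ` {..<2 ^ m} = {..<2 ^ m}" "(\<lambda>x. x XOR f x) ` {..<2 ^ m} = {..<2 ^ m}"
      by (rule endo_inj_surj; use injs in \<open>auto simp: nesting_map_less xor_less_exp\<close>)+
    then obtain u v where u: "u < 2 ^ m" "f u = c" and v: "v < 2 ^ m" "v XOR f v = c"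
      using c(1) by (metis (no_types, lifting) imageE lessThan_iff)
    have u0: "u \<noteq> 0" and v0: "v \<noteq> 0"
      by (rule notI; use u v c f0 in simp)+
    have solve: "{d. d < 2 ^ m \<and> d \<noteq> 0 \<and> c \<in> plane f d} = {c, u, v}"
    proof -
      have "f d = c \<longleftrightarrow> d = u" "d XOR f d = c \<longleftrightarrow> d = v" if "d < 2 ^ m" for d
        using that u v inj_onD[OF injs(1), of d u] inj_onD[OF injs(2), of d v] by auto
      moreover have "c \<in> plane f d \<longleftrightarrow> d = c \<or> f d = c \<or> d XOR f d = c" for d
        using c(2) unfolding plane_def by blast
      ultimately show ?thesis using c u(1) v(1) u0 v0 by blast
    qed
    \<comment> \<open>The three coincidences would give \<open>f u = u\<close>,
      \<open>f v = 0\<close> and \<open>u = 0\<close> respectively.\<close>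
    have "c \<noteq> u" using nesting_map_distinct[OF u(1) u0] u(2) by blast
    moreover have "c \<noteq> v" using nesting_map_distinct[OF v(1) v0] v(2) xor_same_iff by metis
    moreover have "u \<noteq> v" using u(2) v(2) u0 xor_same_iff by metis
    ultimately have "card {c, u, v} = 3" by simp
    moreover have "inj_on (\<lambda>d. (XOR) a ` plane f d) {c, u, v}"
      using plane_inj unfolding solve[symmetric] by (auto simp: inj_on_def xor_image_eq_iff)
    moreover have "{B \<in> \<Union> ` split_planes m f. P \<subseteq> B} = (\<lambda>d. (XOR) a ` plane f d) ` {c, u, v}"
    proof (intro equalityI subsetI)
      fix B assume "B \<in> {B \<in> \<Union> ` split_planes m f. P \<subseteq> B}"
      then have "B \<in> \<Union> ` split_planes m f" and ab: "a \<in> B" "b \<in> B"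
        by (simp_all add: P(1))
      then obtain x d where B: "B = (XOR) x ` plane f d" "d < 2 ^ m" "d \<noteq> 0"
        unfolding Union_split_planes by auto
      \<comment> \<open>With base point \<open>a\<close>, containing \<open>b\<close> means that the
        plane through 0 contains \<open>c\<close>.\<close>
      then have Ba: "B = (XOR) a ` plane f d" using block_translate(2) ab(1) by simp
      then have "c \<in> plane f d" using ab(2) by (auto simp: c_def xor_cancel)
      then show "B \<in> (\<lambda>d. (XOR) a ` plane f d) ` {c, u, v}"
        unfolding solve[symmetric] using B Ba by blast
    next
      fix B assume "B \<in> (\<lambda>d. (XOR) a ` plane f d) ` {c, u, v}"
      then obtain d where d: "d < 2 ^ m" "d \<noteq> 0" "c \<in> plane f d" "B = (XOR) a ` plane f d"
        unfolding solve[symmetric] by blast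
      have "0 \<in> plane f d" by (simp add: plane_def)
      from imageI[OF this, of "(XOR) a"] imageI[OF d(3), of "(XOR) a"]
      have "a XOR 0 \<in> B" "a XOR c \<in> B" unfolding d(4) .
      then have "P \<subseteq> B" by (simp add: P(1) c_def xor_cancel)
      moreover have "\<Union> (split_plane f a d) \<in> \<Union> ` split_planes m f"
        using d P(3) unfolding split_planes_def by (intro imageI) blast
      then have "B \<in> \<Union> ` split_planes m f" by (simp only: d(4) Union_split_plane)
      ultimately show "B \<in> {B \<in> \<Union> ` split_planes m f. P \<subseteq> B}" by simp
    qed
    ultimately show ?thesis by (simp only: card_image)
  qed
  ultimately show ?thesis by (simp add: design_2_4_def)
qed

end

theorem theorem4p7:
  fixes m :: nat
  assumes "m \<ge> 3"
  shows "\<exists>(V :: nat set) (S :: nat set set set).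
           nested_design_2_4 (2 ^ m) 3 V S \<and> completely_uniform V S"
proof -
  obtain f where f: "nesting_map m f" using nesting_map_exists[OF assms] by blast
  have "nested_design_2_4 (2 ^ m) 3 {..<2 ^ m} (split_planes m f)"
    using Union_inj_on_split_planes[OF f] split_planes_design[OF f] split_plane_is_split_block[OF f]
    by (auto simp: nested_design_2_4_def split_planes_def)
  moreover have "completely_uniform {..<2 ^ m} (split_planes m f)"
    using split_planes_multiplicity[OF f] by (auto simp: completely_uniform_def)
  ultimately show ?thesis by blast
qed

end
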